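(* Let $0<p<1$ and let $(G_m)_{m\ge 0}$ be the duplication--deletion random graph process with parameter $p$. Let $N_m$ be the number of vertices of $G_m$ and let $D_{m,k}$ be the number of vertices of degree $k-1$ in $G_m$ (equivalently, the number of vertices lying in cliques of size $k$). Then there is a unique positive bounded sequence $(d_k)_{k=0}^\infty$ satisfying $$d_0=\frac{1-p}{p},\qquad d_k=\frac{pk\,d_{k-1}+(1-p)k\,d_{k+1}}{k+p}\quad (k\ge 1),$$ and for this sequence, for each $k\ge 1$, $$\liminf_{m\to\infty}\frac{D_{m,k}}{N_m}\ge d_k\quad\text{almost surely}.$$
   Context: The duplication--deletion random graph process with parameter $p\in(0,1)$: $G_0$ consists of a single isolated vertex. For each integer $m\ge 1$, $G_m$ is generated from $G_{m-1}$ by one of the following steps, the type of step being chosen independently of the past. (i) With probability $p$, a duplication step: choose a vertex $v$ of $G_{m-1}$ uniformly at random, introduce a new vertex $w$, and add edges between $w$ and all neighbours of $v$, and also an edge between $v$ and $w$. (ii) With probability $1-p$, a deletion step: choose a vertex of $G_{m-1}$ uniformly at random and make it isolated by deleting all edges incident to it (the vertex itself remains). At every time the graph is a disjoint union of cliques; a clique of size $k$ means a connected component that is a complete graph on $k$ vertices. *)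

theory Defs
  imports "HOL-Probability.Probability"
begin

text \<open>Finite simple graphs are pairs of a vertex set and a set of two-element edges.\<close>

type_synonym ugraph = "nat set \<times> nat set set"

abbreviation verts :: "ugraph \<Rightarrow> nat set" where
  "verts \<equiv> fst"

abbreviation edges :: "ugraph \<Rightarrow> nat set set" where
  "edges \<equiv> snd"

definition neighbours :: "ugraph \<Rightarrow> nat \<Rightarrow> nat set" where
  "neighbours g v = {u \<in> verts g. {u, v} \<in> edges g}"

definition vdegree :: "ugraph \<Rightarrow> nat \<Rightarrow> nat" where
  "vdegree g v = card (neighbours g v)"

definition single_vertex :: ugraph where
  "single_vertex = ({0}, {})"

text \<open>The label of the new vertex is immaterial; we take the least unused number, so that
  every graph arising in the process has a vertex set of the form \<open>{..<n}\<close>.\<close>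

definition fresh_vertex :: "ugraph \<Rightarrow> nat" where
  "fresh_vertex g = (LEAST w. w \<notin> verts g)"

definition duplicate_vertex :: "nat \<Rightarrow> ugraph \<Rightarrow> ugraph" where
  "duplicate_vertex v g =
    (let w = fresh_vertex g
     in (insert w (verts g), edges g \<union> {{w, u} |u. u \<in> neighbours g v} \<union> {{v, w}}))"

definition isolate_vertex :: "nat \<Rightarrow> ugraph \<Rightarrow> ugraph" where
  "isolate_vertex v g = (verts g, {e \<in> edges g. v \<notin> e})"

definition dup_del_step :: "real \<Rightarrow> ugraph \<Rightarrow> ugraph pmf" where
  "dup_del_step p g =
    do {
      dup \<leftarrow> bernoulli_pmf p;
      v \<leftarrow> pmf_of_set (verts g);
      return_pmf (if dup then duplicate_vertex v g else isolate_vertex v g)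
    }"

text \<open>The process on an arbitrary probability space: conditionally on any history of positive
  probability, the next graph is distributed according to \<open>dup_del_step\<close> applied to the
  current graph.  This determines the law of the whole sequence.\<close>

locale dup_del_process = prob_space M for M :: "'a measure" +
  fixes p :: real and G :: "nat \<Rightarrow> 'a \<Rightarrow> ugraph"
  assumes measurable_G: "\<And>m. G m \<in> measurable M (count_space UNIV)"
    and initial: "AE \<omega> in M. G 0 \<omega> = single_vertex"
    and transition:
      "\<And>m g h. \<P>(\<omega> in M. \<forall>i\<le>m. G i \<omega> = g i) > 0 \<Longrightarrow>
         \<P>(\<omega> in M. G (Suc m) \<omega> = h \<bar> \<forall>i\<le>m. G i \<omega> = g i) = pmf (dup_del_step p (g m)) h"

definition num_vertices :: "ugraph \<Rightarrow> nat" where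
  "num_vertices g = card (verts g)"

text \<open>The number of vertices of degree \<open>k - 1\<close>, meant for \<open>k \<ge> 1\<close>.\<close>

definition num_deg_pred :: "ugraph \<Rightarrow> nat \<Rightarrow> nat" where
  "num_deg_pred g k = card {v \<in> verts g. vdegree g v + 1 = k}"

definition pos_bdd_solution :: "real \<Rightarrow> (nat \<Rightarrow> real) \<Rightarrow> bool" where
  "pos_bdd_solution p d \<longleftrightarrow>
     (\<forall>k. d k > 0) \<and> bounded (range d) \<and>
     d 0 = (1 - p) / p \<and>
     (\<forall>k\<ge>1. d k = (p * real k * d (k - 1) + (1 - p) * real k * d (k + 1)) / (real k + p))"

end

theory Submission
  imports Defs "HOL-Library.Discrete_Functions"
begin

text \<open>
  Write \<open>D\<^sub>0 = d\<^sub>0 N\<close>.  Given the past, the mean increment of \<open>D\<^sub>k\<close> is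
  \<open>(k / N) (p D\<^sub>k\<^sub>-\<^sub>1 + (1 - p) D\<^sub>k\<^sub>+\<^sub>1 - D\<^sub>k)\<close> for every \<open>k \<ge> 1\<close>, and the compensated sums are
  martingales with bounded increments, hence \<open>o(m)\<close> almost surely; likewise \<open>N\<^sub>m / m \<rightarrow> p\<close>.
  A deterministic comparison shows that the lower limits \<open>b\<^sub>k\<close> of \<open>D\<^sub>k / N\<close> form a
  supersolution: \<open>(k + p) b\<^sub>k \<ge> k (p b\<^sub>k\<^sub>-\<^sub>1 + (1 - p) b\<^sub>k\<^sub>+\<^sub>1)\<close> with \<open>b\<^sub>0 = d\<^sub>0\<close>.  A maximum principle
  for bounded subsolutions then gives both \<open>b \<ge> d\<close> and the uniqueness of \<open>d\<close>; existence follows by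
  monotone iteration from below, bounded by the constant supersolution \<open>d\<^sub>0\<close>.
\<close>

subsection \<open>The recurrence\<close>

text \<open>If \<open>e\<close> is positive at a first index \<open>s\<close>, then from there on it is increasing with
  \<open>e (k + 1) - e k \<ge> p * e s / k\<close>, which contradicts boundedness because the harmonic series diverges.\<close>

lemma bounded_subsolution_nonpos:
  fixes e :: "nat \<Rightarrow> real"
  assumes p: "0 < p" "p < 1" and bdd: "\<And>k. e k \<le> B" and e0: "e 0 \<le> 0"
    and sub: "\<And>k. k \<ge> 1 \<Longrightarrow> (real k + p) * e k \<le> real k * (p * e (k - 1) + (1 - p) * e (k + 1))"
  shows "e k \<le> 0"
proof (rule ccontr)
  assume "\<not> e k \<le> 0"
  define s where "s = (LEAST k. e k > 0)"
  have s: "e s > 0"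
    unfolding s_def using \<open>\<not> e k \<le> 0\<close> LeastI[of "\<lambda>k. e k > 0" k] by simp
  have "s \<ge> 1"
    using s e0 by (cases s) auto
  have "e (s - 1) \<le> 0"
    using not_less_Least[of "s - 1" "\<lambda>k. e k > 0"] \<open>s \<ge> 1\<close> unfolding s_def[symmetric] by force
  have step: "e (k + 1) - e k \<ge> p * e s / real k"
    if "k \<ge> 1" "e k \<ge> e (k - 1)" "e k \<ge> e s" for k
  proof -
    have "real k * (1 - p) * (e (k + 1) - e k) \<ge> real k * p * (e k - e (k - 1)) + p * e k"
      using sub[OF that(1)] by (simp add: algebra_simps)
    moreover have "real k * p * (e k - e (k - 1)) \<ge> 0"
      using that p by (intro mult_nonneg_nonneg) auto
    moreover have "p * e s \<le> p * e k"
      using that p by (intro mult_left_mono) auto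
    ultimately have *: "p * e s \<le> real k * ((1 - p) * (e (k + 1) - e k))"
      by (simp only: mult.assoc)
    \<comment> \<open>The increment must be shown positive first: only then does replacing the
      factor \<open>1 - p\<close> by 1 enlarge the right-hand side.\<close>
    moreover have "p * e s > 0"
      using p s by simp
    ultimately have "0 < real k * ((1 - p) * (e (k + 1) - e k))"
      by linarith
    then have "(1 - p) * (e (k + 1) - e k) > 0"
      using \<open>k \<ge> 1\<close> by (subst (asm) zero_less_mult_iff) simp
    then have "e (k + 1) - e k > 0"
      using p by (simp add: zero_less_mult_iff)
    then have "(1 - p) * (e (k + 1) - e k) \<le> 1 * (e (k + 1) - e k)"
      using p by (intro mult_right_mono) auto
    then have "p * e s \<le> real k * (e (k + 1) - e k)"
      using * mult_left_mono[of "(1 - p) * (e (k + 1) - e k)" "e (k + 1) - e k" "real k"] by simp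
    then show ?thesis
      using \<open>k \<ge> 1\<close> by (simp add: pos_divide_le_eq mult.commute)
  qed
  \<comment> \<open>The case \<open>j = 0\<close> is the minimality of \<open>s\<close>, which gives
    \<open>e (s - 1) \<le> 0 < e s\<close>; afterwards \<open>step\<close> keeps its own hypotheses
    alive.\<close>
  have mono: "e (s + j) \<ge> e (s + j - 1) \<and> e (s + j) \<ge> e s" for j
  proof (induction j)
    case 0
    then show ?case using s \<open>e (s - 1) \<le> 0\<close> by simp
  next
    case (Suc j)
    have "p * e s / real (s + j) \<ge> 0" using p s by simp
    then show ?case using step[of "s + j"] Suc \<open>s \<ge> 1\<close> by simp
  qed
  have sum: "p * e s * (\<Sum>i<j. inverse (real (i + s))) \<le> e (s + j)" for j
  proof (induction j)
    case 0
    then show ?case using s by simp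
  next
    case (Suc j)
    have "p * e s * (\<Sum>i<Suc j. inverse (real (i + s)))
        = p * e s * (\<Sum>i<j. inverse (real (i + s))) + p * e s / real (s + j)"
      by (simp add: distrib_left divide_inverse add.commute)
    also have "\<dots> \<le> e (s + j) + (e (s + j + 1) - e (s + j))"
      using mono[of j] \<open>s \<ge> 1\<close> by (intro add_mono Suc step) auto
    finally show ?case by simp
  qed
  have "(\<Sum>i<j. inverse (real (i + s))) \<le> B / (p * e s)" for j
    using order_trans[OF sum bdd, of j] p s by (simp add: pos_le_divide_eq mult.commute)
  then have "summable (\<lambda>i. inverse (real (i + s)))"
    by (intro summableI_nonneg_bounded) auto
  then have "summable (\<lambda>n. inverse (real n))"
    using summable_iff_shift[of "\<lambda>n. inverse (real n)" s] by simp
  then show False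
    using not_summable_harmonic[where 'a=real] by simp
qed

text \<open>Fixed-point iteration of the recurrence with the boundary value at 0 held fixed.
  Starting from zero elsewhere makes the iterates increase in \<open>j\<close>.\<close>

fun approx_solution :: "real \<Rightarrow> nat \<Rightarrow> nat \<Rightarrow> real" where
  "approx_solution p 0 k = (if k = 0 then (1 - p) / p else 0)"
| "approx_solution p (Suc j) k = (if k = 0 then (1 - p) / p
     else (p * real k * approx_solution p j (k - 1)
            + (1 - p) * real k * approx_solution p j (k + 1)) / (real k + p))"

lemma approx_solution_0: "approx_solution p j 0 = (1 - p) / p"
  by (cases j) auto

lemma approx_solution_nonneg:
  assumes "0 < p" "p < 1"
  shows "approx_solution p j k \<ge> 0"
  by (induction j arbitrary: k) (use assms in auto)

text \<open>The two coefficients of the recurrence are nonnegative with sum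
  \<open>k / (k + p) \<le> 1\<close>, so an upper bound by the boundary value is passed on to the
  next iterate.\<close>

lemma approx_solution_le:
  assumes "0 < p" "p < 1"
  shows "approx_solution p j k \<le> (1 - p) / p"
proof (induction j arbitrary: k)
  case 0
  then show ?case using assms by simp
next
  case (Suc j)
  let ?c = "(1 - p) / p"
  have c: "?c \<ge> 0" using assms by simp
  have "p * real k * approx_solution p j (k - 1) + (1 - p) * real k * approx_solution p j (k + 1)
      \<le> p * real k * ?c + (1 - p) * real k * ?c"
    using assms Suc by (intro add_mono mult_left_mono) auto
  also have "\<dots> = real k * ?c"
    by (simp add: algebra_simps)
  also have "\<dots> \<le> (real k + p) * ?c"
    using c assms by (intro mult_right_mono) auto
  finally show ?case
    using assms by (simp add: pos_divide_le_eq mult.commute)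
qed

text \<open>The recurrence map is monotone, so the comparison of the first two iterates
  propagates.\<close>

lemma approx_solution_mono:
  assumes "0 < p" "p < 1"
  shows "approx_solution p j k \<le> approx_solution p (Suc j) k"
proof (induction j arbitrary: k)
  case 0
  then show ?case using approx_solution_nonneg[OF assms] assms by simp
next
  case (Suc j)
  have "(p * real k * approx_solution p j (k - 1) + (1 - p) * real k * approx_solution p j (k + 1))
        / (real k + p)
      \<le> (p * real k * approx_solution p (Suc j) (k - 1)
            + (1 - p) * real k * approx_solution p (Suc j) (k + 1)) / (real k + p)"
    using assms by (intro divide_right_mono add_mono mult_left_mono Suc) auto
  then show ?case
    by (simp only: approx_solution.simps(2) split: if_split) simp
qed

lemma pos_bdd_solution_exists:
  assumes p: "0 < p" "p < 1"
  shows "\<exists>d. pos_bdd_solution p d"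
proof -
  define a where "a = approx_solution p"
  define d where "d k = lim (\<lambda>j. a j k)" for k
  have lim: "(\<lambda>j. a j k) \<longlonglongrightarrow> d k" for k
  proof -
    have "Bseq (\<lambda>j. a j k)"
      using approx_solution_le[OF p] approx_solution_nonneg[OF p]
      by (intro BseqI'[of _ "(1 - p) / p"]) (simp add: a_def)
    moreover have "incseq (\<lambda>j. a j k)"
      unfolding a_def by (rule incseq_SucI) (rule approx_solution_mono[OF p])
    ultimately have "convergent (\<lambda>j. a j k)"
      by (intro Bseq_mono_convergent) (auto dest: incseqD)
    then show ?thesis
      unfolding d_def by (simp add: convergent_LIMSEQ_iff)
  qed
  have nonneg: "d k \<ge> 0" for k
    by (rule LIMSEQ_le_const[OF lim]) (use approx_solution_nonneg[OF p] in \<open>auto simp: a_def\<close>)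
  have le: "d k \<le> (1 - p) / p" for k
    by (rule LIMSEQ_le_const2[OF lim]) (use approx_solution_le[OF p] in \<open>auto simp: a_def\<close>)
  have d0: "d 0 = (1 - p) / p"
    using LIMSEQ_unique[OF lim[of 0]] by (simp add: a_def approx_solution_0)
  have rec: "d k = (p * real k * d (k - 1) + (1 - p) * real k * d (k + 1)) / (real k + p)"
    if "k \<ge> 1" for k
  proof (rule LIMSEQ_unique[OF LIMSEQ_Suc[OF lim]])
    have "(\<lambda>j. (p * real k * a j (k - 1) + (1 - p) * real k * a j (k + 1)) / (real k + p))
        \<longlonglongrightarrow> (p * real k * d (k - 1) + (1 - p) * real k * d (k + 1)) / (real k + p)"
      by (intro tendsto_intros lim) (use p in auto)
    then show "(\<lambda>j. a (Suc j) k)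
        \<longlonglongrightarrow> (p * real k * d (k - 1) + (1 - p) * real k * d (k + 1)) / (real k + p)"
      using that by (simp add: a_def)
  qed
  \<comment> \<open>The limit only inherits nonnegativity. Positivity spreads upwards from
    \<open>d 0\<close>, since \<open>d k\<close> enters the equation for \<open>d (Suc k)\<close>
    with a positive coefficient.\<close>
  have "d k > 0" for k
  proof (induction k)
    case 0
    then show ?case using p d0 by simp
  next
    case (Suc k)
    have "0 < p * real (Suc k) * d k + (1 - p) * real (Suc k) * d (Suc k + 1)"
      using p Suc nonneg[of "Suc k + 1"] by (intro add_pos_nonneg) auto
    then show ?case
      using rec[of "Suc k"] p by (simp add: add_pos_pos)
  qed
  moreover have "bounded (range d)"
    using le nonneg by (intro boundedI[where B="(1 - p) / p"]) auto
  ultimately show ?thesis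
    using d0 rec unfolding pos_bdd_solution_def by blast
qed

lemma pos_bdd_solution_recurrence:
  assumes p: "0 < p" "p < 1" and d: "pos_bdd_solution p d" and k: "k \<ge> 1"
  shows "(real k + p) * d k = real k * (p * d (k - 1) + (1 - p) * d (k + 1))"
proof -
  have "d k = (p * real k * d (k - 1) + (1 - p) * real k * d (k + 1)) / (real k + p)"
    using d k unfolding pos_bdd_solution_def by blast
  moreover have "real k + p \<noteq> 0"
    using p by simp
  ultimately have "(real k + p) * d k = p * real k * d (k - 1) + (1 - p) * real k * d (k + 1)"
    by (metis mult.commute nonzero_eq_divide_eq)
  then show ?thesis
    by (simp only: distrib_left mult.left_commute mult.assoc)
qed

text \<open>The difference \<open>d - b\<close> is a subsolution, nonpositive at 0 and bounded above
  because \<open>d\<close> is bounded and \<open>b\<close> nonnegative, so the maximum principle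
  applies.\<close>

lemma pos_bdd_solution_le_supersolution:
  assumes p: "0 < p" "p < 1" and d: "pos_bdd_solution p d"
    and b0: "b 0 \<ge> (1 - p) / p" and nonneg: "\<And>k. b k \<ge> 0"
    and super: "\<And>k. k \<ge> 1 \<Longrightarrow> (real k + p) * b k \<ge> real k * (p * b (k - 1) + (1 - p) * b (k + 1))"
  shows "d k \<le> b k"
proof -
  obtain B where B: "\<And>k. \<bar>d k\<bar> \<le> B"
    using d unfolding pos_bdd_solution_def bounded_iff by (metis rangeI real_norm_def)
  have "d k - b k \<le> 0"
  proof (rule bounded_subsolution_nonpos[OF p, of _ B])
    show "d k - b k \<le> B" for k
      using B[of k] nonneg[of k] by linarith
    show "d 0 - b 0 \<le> 0"
      using d b0 unfolding pos_bdd_solution_def by linarith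
    show "(real k + p) * (d k - b k)
        \<le> real k * (p * (d (k - 1) - b (k - 1)) + (1 - p) * (d (k + 1) - b (k + 1)))"
      if "k \<ge> 1" for k
      using super[OF that] pos_bdd_solution_recurrence[OF p d that] by (simp add: algebra_simps)
  qed
  then show ?thesis by simp
qed

text \<open>Every solution is also a supersolution, so the comparison works in both
  directions.\<close>

lemma pos_bdd_solution_unique:
  assumes p: "0 < p" "p < 1" and d: "pos_bdd_solution p d" "pos_bdd_solution p d'"
  shows "d = d'"
proof -
  have "d k \<le> d' k" if d: "pos_bdd_solution p d" and d': "pos_bdd_solution p d'" for d d' k
  proof (rule pos_bdd_solution_le_supersolution[OF p d])
    show "d' 0 \<ge> (1 - p) / p" "d' k \<ge> 0" for k
      using d' unfolding pos_bdd_solution_def by (metis order_refl, metis less_imp_le)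
    show "(real k + p) * d' k \<ge> real k * (p * d' (k - 1) + (1 - p) * d' (k + 1))"
      if "k \<ge> 1" for k
      by (simp only: pos_bdd_solution_recurrence[OF p d' that] order_refl)
  qed
  from this[OF d] this[OF d(2,1)] show ?thesis
    by (intro ext antisym)
qed

subsection \<open>Asymptotics of perturbed linear recursions\<close>

text \<open>After removing the error \<open>E\<close> and a line \<open>c * m\<close> of slope \<open>c < p * k * \<beta> / (k + p)\<close>, the sequence
  satisfies \<open>z (m + 1) \<ge> (1 - k / n m) * z m\<close> eventually, hence is bounded below.\<close>

lemma eventually_ratio_ge:
  fixes x n u :: "nat \<Rightarrow> real"
  assumes p: "p > 0" and k: "k > 0" and n: "(\<lambda>m. n m / real m) \<longlonglongrightarrow> p"
    and err: "(\<lambda>m. (x m - (\<Sum>i<m. k / n i * (u i - x i))) / real m) \<longlonglongrightarrow> 0"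
    and u: "\<forall>\<^sub>F m in sequentially. u m \<ge> \<beta> * n m"
    and \<gamma>: "\<gamma> < k * \<beta> / (k + p)"
  shows "\<forall>\<^sub>F m in sequentially. x m / n m \<ge> \<gamma>"
proof -
  define E where "E m = x m - (\<Sum>i<m. k / n i * (u i - x i))" for m
  define y where "y m = x m - E m" for m
  have E: "(\<lambda>m. E m / real m) \<longlonglongrightarrow> 0"
    using err by (simp add: E_def)
  have y_Suc: "y (Suc m) = y m + k / n m * (u m - y m - E m)" for m
    by (simp add: y_def E_def)
  obtain \<gamma>' where \<gamma>': "\<gamma> < \<gamma>'" "\<gamma>' < k * \<beta> / (k + p)"
    using dense[OF \<gamma>] by blast
  \<comment> \<open>As \<open>n m\<close> is asymptotic to \<open>p * m\<close>, the line
    \<open>c * m\<close> is asymptotic to \<open>\<gamma>' * n m\<close>. The room between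
    \<open>\<gamma>\<close> and \<open>\<gamma>'\<close> absorbs the errors at the end.\<close>
  define c where "c = p * \<gamma>'"
  have n_pos: "\<forall>\<^sub>F m in sequentially. n m > 0"
    using order_tendstoD(1)[OF n p] eventually_gt_at_top[of 0]
    by eventually_elim (auto simp: zero_less_divide_iff)
  have mn: "(\<lambda>m. real m / n m) \<longlonglongrightarrow> 1 / p"
    using tendsto_inverse[OF n] p by (simp add: divide_inverse mult.commute)
  have n_top: "filterlim n at_top sequentially"
  proof -
    have "filterlim (\<lambda>m. n m / real m * real m) at_top sequentially"
      by (rule filterlim_tendsto_pos_mult_at_top[OF n p filterlim_real_sequentially])
    moreover have "\<forall>\<^sub>F m in sequentially. n m / real m * real m = n m"
      using eventually_gt_at_top[of 0] by eventually_elim auto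
    ultimately show ?thesis
      by (rule filterlim_mono_eventually[OF _ order_refl order_refl])
  qed
  have "(\<lambda>m. k * (\<beta> - E m / real m * (real m / n m)) - c - k * c * (real m / n m))
      \<longlonglongrightarrow> k * (\<beta> - 0 * (1 / p)) - c - k * c * (1 / p)"
    by (intro tendsto_intros E mn)
  \<comment> \<open>With \<open>c = p * \<gamma>'\<close> this says
    \<open>(k + p) * \<gamma>' < k * \<beta>\<close>, which is the choice of
    \<open>\<gamma>'\<close>.\<close>
  moreover have "k * (\<beta> - 0 * (1 / p)) - c - k * c * (1 / p) > 0"
    using \<gamma>'(2) p k by (simp add: c_def field_simps)
  ultimately have gap: "\<forall>\<^sub>F m in sequentially.
      k * (\<beta> - E m / real m * (real m / n m)) - c - k * c * (real m / n m) > 0"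
    by (rule order_tendstoD(1))
  define z where "z m = y m - c * real m" for m
  have "\<forall>\<^sub>F m in sequentially. 0 \<le> 1 - k / n m \<and> 1 - k / n m \<le> 1
      \<and> z (Suc m) \<ge> (1 - k / n m) * z m"
    using gap n_pos filterlim_at_top[THEN iffD1, OF n_top, rule_format, of k] u
      eventually_gt_at_top[of 0]
  proof eventually_elim
    case (elim m)
    have "z (Suc m) - (1 - k / n m) * z m = k * (u m / n m - E m / n m) - c - k * c * (real m / n m)"
      using elim by (simp add: z_def y_Suc field_simps)
    also have "\<dots> \<ge> k * (\<beta> - E m / n m) - c - k * c * (real m / n m)"
      using elim k by (simp add: field_simps)
    finally show ?case
      using elim k by simp
  qed
  then obtain m0 where m0: "\<And>m. m \<ge> m0 \<Longrightarrow> 0 \<le> 1 - k / n m \<and> 1 - k / n m \<le> 1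
      \<and> z (Suc m) \<ge> (1 - k / n m) * z m"
    by (auto simp: eventually_sequentially)
  have z: "z m \<ge> - \<bar>z m0\<bar>" if "m \<ge> m0" for m
    using that
  proof (induction m rule: dec_induct)
    case (step m)
    \<comment> \<open>A factor in [0, 1] moves a nonpositive bound towards 0, so the bound is
      inductive.\<close>
    have "- \<bar>z m0\<bar> \<le> (1 - k / n m) * (- \<bar>z m0\<bar>)"
      using m0[OF step(1)] mult_right_mono[of "1 - k / n m" 1 "\<bar>z m0\<bar>"] by simp
    also have "\<dots> \<le> (1 - k / n m) * z m"
      using m0[OF step(1)] step by (intro mult_left_mono) auto
    finally show ?case using m0[OF step(1)] by linarith
  qed auto
  have "(\<lambda>m. (E m / real m + c - \<bar>z m0\<bar> / real m) * (real m / n m))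
      \<longlonglongrightarrow> (0 + c - 0) * (1 / p)"
    by (intro tendsto_intros E mn lim_const_over_n)
  moreover have "(0 + c - 0) * (1 / p) > \<gamma>"
    using \<gamma>' p by (simp add: c_def)
  ultimately have "\<forall>\<^sub>F m in sequentially. (E m / real m + c - \<bar>z m0\<bar> / real m) * (real m / n m) > \<gamma>"
    by (rule order_tendstoD(1))
  then show ?thesis
    using eventually_ge_at_top[of m0] n_pos eventually_gt_at_top[of 0]
  proof eventually_elim
    case (elim m)
    have "(E m / real m + c - \<bar>z m0\<bar> / real m) * (real m / n m) = (E m + c * real m - \<bar>z m0\<bar>) / n m"
      using elim by (simp add: field_simps)
    also have "\<dots> \<le> x m / n m"
      using elim z[of m] by (intro divide_right_mono) (auto simp: z_def y_def)
    finally show ?case using elim by linarith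
  qed
qed

subsection \<open>A strong law of large numbers\<close>

text \<open>Borel--Cantelli along the squares \<open>n\<^sup>2\<close>; the increments between consecutive squares are \<open>O(n)\<close>.\<close>

lemma (in prob_space) AE_lim_over_n_second_moment:
  fixes X :: "nat \<Rightarrow> 'a \<Rightarrow> real"
  assumes meas [measurable]: "\<And>m. X m \<in> borel_measurable M"
    and int: "\<And>m. integrable M (\<lambda>\<omega>. (X m \<omega>)\<^sup>2)"
    and second: "\<And>m. expectation (\<lambda>\<omega>. (X m \<omega>)\<^sup>2) \<le> C * real m"
    and incr: "\<And>m. AE \<omega> in M. \<bar>X (Suc m) \<omega> - X m \<omega>\<bar> \<le> c"
  shows "AE \<omega> in M. (\<lambda>m. X m \<omega> / real m) \<longlonglongrightarrow> 0"
proof -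
  \<comment> \<open>The mean of \<open>Y n\<close> is at most \<open>C * n^2 / n^4\<close>, which is
    summable; hence the series of the \<open>Y n\<close> is almost surely finite and its terms tend
    to 0.\<close>
  define Y where "Y n \<omega> = (X (n\<^sup>2) \<omega> / real (n\<^sup>2))\<^sup>2" for n \<omega>
  have [measurable]: "Y n \<in> borel_measurable M" for n
    unfolding Y_def by measurable
  have Yle: "(\<integral>\<^sup>+ \<omega>. ennreal (Y n \<omega>) \<partial>M) \<le> ennreal (C * (1 / real n ^ 2))" for n
  proof -
    have "(\<integral>\<^sup>+ \<omega>. ennreal (Y n \<omega>) \<partial>M) = ennreal (expectation (Y n))"
      using int unfolding Y_def power_divide
      by (intro nn_integral_eq_integral) auto
    also have "expectation (Y n) = expectation (\<lambda>\<omega>. (X (n\<^sup>2) \<omega>)\<^sup>2) / (real (n\<^sup>2))\<^sup>2"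
      unfolding Y_def power_divide by simp
    also have "\<dots> \<le> C * real (n\<^sup>2) / (real (n\<^sup>2))\<^sup>2"
      using second[of "n\<^sup>2"] by (intro divide_right_mono) auto
    also have "\<dots> = C * (1 / real n ^ 2)"
      \<comment> \<open>At \<open>n = 0\<close> both sides are 0 because division by zero yields
        0.\<close>
      by (cases "n = 0") (auto simp: field_simps power2_eq_square)
    finally show ?thesis by (simp add: ennreal_leI)
  qed
  have C: "C \<ge> 0"
    using order_trans[OF integral_nonneg_AE second[of 1]] by simp
  have "(\<integral>\<^sup>+ \<omega>. (\<Sum>n. ennreal (Y n \<omega>)) \<partial>M) = (\<Sum>n. \<integral>\<^sup>+ \<omega>. ennreal (Y n \<omega>) \<partial>M)"
    by (rule nn_integral_suminf) measurable
  also have "\<dots> \<le> (\<Sum>n. ennreal (C * (1 / real n ^ 2)))"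
    by (intro suminf_le Yle) auto
  also have "\<dots> < \<infinity>"
  proof -
    have "summable (\<lambda>n. C * (1 / real n ^ 2))"
      by (intro summable_mult) (use inverse_power_summable[of 2, where 'a=real] in \<open>simp add: field_simps\<close>)
    then show ?thesis
      using C by (subst suminf_ennreal2) auto
  qed
  finally have "(\<integral>\<^sup>+ \<omega>. (\<Sum>n. ennreal (Y n \<omega>)) \<partial>M) \<noteq> \<infinity>" by simp
  then have "AE \<omega> in M. (\<Sum>n. ennreal (Y n \<omega>)) \<noteq> \<infinity>"
    by (intro nn_integral_noteq_infinite) measurable
  then have sq: "AE \<omega> in M. (\<lambda>n. X (n\<^sup>2) \<omega> / real (n\<^sup>2)) \<longlonglongrightarrow> 0"
  proof eventually_elim
    case (elim \<omega>)
    then have "summable (\<lambda>n. Y n \<omega>)"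
      by (intro summable_suminf_not_top) (auto simp: Y_def)
    then have "(\<lambda>n. Y n \<omega>) \<longlonglongrightarrow> 0"
      by (rule summable_LIMSEQ_zero)
    then have "(\<lambda>n. sqrt (Y n \<omega>)) \<longlonglongrightarrow> sqrt 0"
      by (rule tendsto_real_sqrt)
    then show ?case
      unfolding Y_def real_sqrt_abs real_sqrt_zero tendsto_rabs_zero_iff .
  qed
  have "AE \<omega> in M. \<forall>m. \<bar>X (Suc m) \<omega> - X m \<omega>\<bar> \<le> c"
    using incr by (simp add: AE_all_countable)
  with sq show ?thesis
  proof eventually_elim
    case (elim \<omega>)
    have c: "c \<ge> 0"
      using elim(2) by (meson abs_ge_zero order_trans)
    have diff: "\<bar>X (m + j) \<omega> - X m \<omega>\<bar> \<le> c * real j" for m j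
    proof (induction j)
      case (Suc j)
      then show ?case
        using elim(2)[rule_format, of "m + j"] by (simp add: algebra_simps)
    qed simp
    \<comment> \<open>The integer square root gives the last square before \<open>m\<close>: from
      \<open>(r m)^2 \<le> m < (r m + 1)^2\<close> the gap is at most \<open>2 * r m\<close>, which
      is negligible after division by \<open>(r m)^2\<close>.\<close>
    define r where "r = floor_sqrt"
    have r: "filterlim r at_top sequentially"
      unfolding filterlim_at_top
    proof
      fix Z
      show "\<forall>\<^sub>F m in sequentially. Z \<le> r m"
        using eventually_ge_at_top[of "Z\<^sup>2"]
        by eventually_elim (simp add: r_def le_floor_sqrt_iff)
    qed
    have "(\<lambda>n. \<bar>X (n\<^sup>2) \<omega> / real (n\<^sup>2)\<bar> + c * (2 / real n)) \<longlonglongrightarrow> \<bar>0\<bar> + c * 0"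
      by (intro tendsto_intros elim(1) lim_const_over_n)
    then have "(\<lambda>n. \<bar>X (n\<^sup>2) \<omega> / real (n\<^sup>2)\<bar> + c * (2 / real n)) \<longlonglongrightarrow> 0"
      by simp
    from filterlim_compose[OF this r]
    have lim: "(\<lambda>m. \<bar>X ((r m)\<^sup>2) \<omega> / real ((r m)\<^sup>2)\<bar> + c * (2 / real (r m))) \<longlonglongrightarrow> 0" .
    show ?case
    proof (rule Lim_null_comparison[OF _ lim])
      show "\<forall>\<^sub>F m in sequentially. norm (X m \<omega> / real m)
          \<le> \<bar>X ((r m)\<^sup>2) \<omega> / real ((r m)\<^sup>2)\<bar> + c * (2 / real (r m))"
        using eventually_ge_at_top[of 1]
      proof eventually_elim
        case (elim m)
        let ?n = "r m"
        have n1: "?n \<ge> 1"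
          using elim by (simp add: r_def le_floor_sqrt_iff)
        have sq_le: "?n\<^sup>2 \<le> m"
          by (simp add: r_def)
        have "m < (Suc ?n)\<^sup>2"
          unfolding r_def by (rule Suc_floor_sqrt_power2_gt)
        then have j: "m - ?n\<^sup>2 \<le> 2 * ?n"
          by (simp add: power2_eq_square)
        have "\<bar>X m \<omega> - X (?n\<^sup>2) \<omega>\<bar> \<le> c * real (m - ?n\<^sup>2)"
          using diff[of "?n\<^sup>2" "m - ?n\<^sup>2"] sq_le by simp
        also have "\<dots> \<le> c * real (2 * ?n)"
          using j c by (intro mult_left_mono) (simp_all only: of_nat_le_iff)
        finally have "\<bar>X m \<omega>\<bar> \<le> \<bar>X (?n\<^sup>2) \<omega>\<bar> + c * real (2 * ?n)"
          by linarith
        then have "\<bar>X m \<omega>\<bar> / real m \<le> (\<bar>X (?n\<^sup>2) \<omega>\<bar> + c * real (2 * ?n)) / real m"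
          by (intro divide_right_mono) auto
        also have "\<dots> \<le> (\<bar>X (?n\<^sup>2) \<omega>\<bar> + c * real (2 * ?n)) / real (?n\<^sup>2)"
          using n1 sq_le c elim by (intro divide_left_mono) (auto simp del: of_nat_power)
        also have "\<dots> = \<bar>X (?n\<^sup>2) \<omega> / real (?n\<^sup>2)\<bar> + c * (2 / real ?n)"
          using n1 by (simp add: field_simps power2_eq_square)
        finally show ?case by simp
      qed
    qed
  qed
qed

subsection \<open>One step of the process on disjoint unions of cliques\<close>

definition closed_nbhd :: "ugraph \<Rightarrow> nat \<Rightarrow> nat set" where
  "closed_nbhd g v = insert v (neighbours g v)"

text \<open>Disjoint unions of cliques are encoded without connectivity: adjacent vertices share
  their closed neighbourhood, so \<open>closed_nbhd g v\<close> is the clique of \<open>v\<close>.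
  Excluding loops \<open>{v}\<close> makes its size the degree plus one.\<close>

definition clique_union :: "ugraph \<Rightarrow> bool" where
  "clique_union g \<longleftrightarrow> finite (verts g) \<and> verts g \<noteq> {} \<and> (\<forall>e\<in>edges g. e \<subseteq> verts g) \<and>
     (\<forall>v. {v} \<notin> edges g) \<and> (\<forall>u v. u \<in> neighbours g v \<longrightarrow> closed_nbhd g u = closed_nbhd g v)"

lemma clique_unionD:
  assumes "clique_union g"
  shows "finite (verts g)" "verts g \<noteq> {}" "e \<in> edges g \<Longrightarrow> e \<subseteq> verts g" "{v} \<notin> edges g"
    "u \<in> closed_nbhd g v \<Longrightarrow> closed_nbhd g u = closed_nbhd g v"
proof -
  show "finite (verts g)" "verts g \<noteq> {}" "e \<in> edges g \<Longrightarrow> e \<subseteq> verts g" "{v} \<notin> edges g"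
    using assms by (simp_all add: clique_union_def)
  assume "u \<in> closed_nbhd g v"
  then have "u = v \<or> u \<in> neighbours g v"
    by (simp add: closed_nbhd_def)
  moreover have "u \<in> neighbours g v \<longrightarrow> closed_nbhd g u = closed_nbhd g v"
    using assms unfolding clique_union_def by blast
  ultimately show "closed_nbhd g u = closed_nbhd g v"
    by blast
qed

lemma closed_nbhd_refl: "v \<in> closed_nbhd g v"
  by (simp add: closed_nbhd_def)

lemma closed_nbhd_eq_if_mem_verts:
  assumes "v \<in> verts g"
  shows "closed_nbhd g v = {u \<in> verts g. u = v \<or> {u, v} \<in> edges g}"
  using assms by (auto simp: closed_nbhd_def neighbours_def)

lemma card_closed_nbhd:
  assumes "clique_union g"
  shows "card (closed_nbhd g v) = vdegree g v + 1"
proof -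
  have "finite (neighbours g v)" "v \<notin> neighbours g v"
    using clique_unionD(1,4)[OF assms] by (auto simp: neighbours_def)
  then show ?thesis
    by (simp add: closed_nbhd_def vdegree_def)
qed

lemma num_deg_pred_eq:
  assumes "clique_union g"
  shows "num_deg_pred g k = card {v \<in> verts g. card (closed_nbhd g v) = k}"
  by (simp add: num_deg_pred_def card_closed_nbhd[OF assms])

lemma fresh_vertex_notin:
  assumes "finite (verts g)"
  shows "fresh_vertex g \<notin> verts g"
proof -
  obtain w where "w \<notin> verts g"
    using ex_new_if_finite[OF infinite_UNIV_nat assms] by blast
  then have "(LEAST w. w \<notin> verts g) \<notin> verts g"
    by (rule LeastI[where P="\<lambda>w. w \<notin> verts g"])
  then show ?thesis
    by (simp only: fresh_vertex_def not_False_eq_True)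
qed

lemma verts_duplicate: "verts (duplicate_vertex v g) = insert (fresh_vertex g) (verts g)"
  by (simp add: duplicate_vertex_def Let_def)

lemma verts_isolate: "verts (isolate_vertex v g) = verts g"
  by (simp add: isolate_vertex_def)

lemma edges_duplicate:
  "edges (duplicate_vertex v g) = edges g \<union> (\<lambda>u. {fresh_vertex g, u}) ` closed_nbhd g v"
  by (auto simp: duplicate_vertex_def Let_def closed_nbhd_def insert_commute)

lemma edges_isolate: "edges (isolate_vertex v g) = {e \<in> edges g. v \<notin> e}"
  by (simp add: isolate_vertex_def)

text \<open>Adjacent to \<open>v\<close> and to all its neighbours, the fresh vertex joins the
  clique of \<open>v\<close>. No old edge meets it, so the other cliques are untouched.\<close>

lemma closed_nbhd_duplicate:
  assumes g: "clique_union g" and v: "v \<in> verts g" and x: "x \<in> insert (fresh_vertex g) (verts g)"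
  shows "closed_nbhd (duplicate_vertex v g) x =
    (if x \<in> insert (fresh_vertex g) (closed_nbhd g v)
     then insert (fresh_vertex g) (closed_nbhd g v) else closed_nbhd g x)"
proof -
  let ?w = "fresh_vertex g"
  have w: "?w \<notin> verts g"
    using g by (intro fresh_vertex_notin clique_unionD)
  have sub: "closed_nbhd g v \<subseteq> verts g"
    using v by (auto simp: closed_nbhd_eq_if_mem_verts)
  have w_edge: "{?w, u} \<notin> edges g" "{u, ?w} \<notin> edges g" for u
    using w clique_unionD(3)[OF g] by blast+
  have eq: "closed_nbhd (duplicate_vertex v g) x =
    {u \<in> insert ?w (verts g). u = x \<or> {u, x} \<in> edges g \<or> (\<exists>y\<in>closed_nbhd g v. {u, x} = {?w, y})}"
    using x by (subst closed_nbhd_eq_if_mem_verts) (auto simp: verts_duplicate edges_duplicate)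
  show ?thesis
  proof (cases "x = ?w")
    case True
    then show ?thesis
      unfolding eq using w w_edge sub by (auto simp: doubleton_eq_iff)
  next
    case False
    then have "x \<in> verts g" using x by simp
    then have "closed_nbhd (duplicate_vertex v g) x =
        closed_nbhd g x \<union> (if x \<in> closed_nbhd g v then {?w} else {})"
      unfolding eq using w w_edge sub False
      by (auto simp: doubleton_eq_iff closed_nbhd_eq_if_mem_verts)
    then show ?thesis
      using False clique_unionD(5)[OF g, of x v] by auto
  qed
qed

text \<open>Deletion removes \<open>v\<close> from the closed neighbourhoods of the other vertices,
  and by symmetry only members of its own clique had \<open>v\<close> there.\<close>

lemma closed_nbhd_isolate:
  assumes g: "clique_union g" and v: "v \<in> verts g" and x: "x \<in> verts g"
  shows "closed_nbhd (isolate_vertex v g) x =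
    (if x = v then {v} else if x \<in> closed_nbhd g v then closed_nbhd g v - {v} else closed_nbhd g x)"
proof -
  have eq: "closed_nbhd (isolate_vertex v g) x =
    {u \<in> verts g. u = x \<or> {u, x} \<in> edges g \<and> v \<noteq> u \<and> v \<noteq> x}"
    using x by (subst closed_nbhd_eq_if_mem_verts) (auto simp: verts_isolate edges_isolate)
  have "closed_nbhd (isolate_vertex v g) x = (if x = v then {v} else closed_nbhd g x - {v})"
    unfolding eq using v x by (auto simp: closed_nbhd_eq_if_mem_verts)
  moreover have "x \<in> closed_nbhd g v \<Longrightarrow> closed_nbhd g x = closed_nbhd g v"
    by (rule clique_unionD(5)[OF g])
  moreover have "v \<in> closed_nbhd g x \<Longrightarrow> x \<in> closed_nbhd g v"
    using closed_nbhd_refl[of x g] clique_unionD(5)[OF g, of v x] by simp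
  ultimately show ?thesis
    by auto
qed

section \<open>Invariance of the clique structure\<close>

lemma clique_union_single: "clique_union single_vertex"
  by (simp add: clique_union_def single_vertex_def neighbours_def)

lemma clique_union_duplicate:
  assumes g: "clique_union g" and v: "v \<in> verts g"
  shows "clique_union (duplicate_vertex v g)"
proof -
  let ?w = "fresh_vertex g" and ?h = "duplicate_vertex v g"
  have w: "?w \<notin> verts g"
    using g by (intro fresh_vertex_notin clique_unionD)
  have sub: "closed_nbhd g v \<subseteq> verts g"
    using v by (auto simp: closed_nbhd_eq_if_mem_verts)
  have w_nbhd: "?w \<in> closed_nbhd g x \<Longrightarrow> x = ?w" for x
    using w by (auto simp: closed_nbhd_def neighbours_def)
  have edges: "e \<subseteq> verts ?h" if "e \<in> edges ?h" for e
    using that clique_unionD(3)[OF g, of e] sub by (auto simp: verts_duplicate edges_duplicate)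
  have "closed_nbhd ?h y = closed_nbhd ?h x" if y: "y \<in> neighbours ?h x" for x y
  proof -
    have "y \<in> closed_nbhd ?h x" "{y, x} \<subseteq> verts ?h"
      using y edges[of "{y, x}"] by (auto simp: closed_nbhd_def neighbours_def)
    then show ?thesis
      using closed_nbhd_duplicate[OF g v, of x] closed_nbhd_duplicate[OF g v, of y] w sub w_nbhd[of x]
      using clique_unionD(5)[OF g, of y x] clique_unionD(5)[OF g, of y v] closed_nbhd_refl[of x g]
      by (auto simp: verts_duplicate split: if_splits)
  qed
  moreover have "{u} \<notin> edges ?h" for u
    using w sub clique_unionD(4)[OF g] by (auto simp: edges_duplicate)
  ultimately show ?thesis
    using edges clique_unionD(1)[OF g] by (auto simp: clique_union_def verts_duplicate)
qed

lemma clique_union_isolate: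
  assumes g: "clique_union g" and v: "v \<in> verts g"
  shows "clique_union (isolate_vertex v g)"
proof -
  let ?h = "isolate_vertex v g"
  have edges: "e \<subseteq> verts ?h" if "e \<in> edges ?h" for e
    using that clique_unionD(3)[OF g, of e] by (auto simp: verts_isolate edges_isolate)
  have "closed_nbhd ?h y = closed_nbhd ?h x" if y: "y \<in> neighbours ?h x" for x y
  proof -
    have "y \<in> closed_nbhd ?h x" "{y, x} \<subseteq> verts ?h"
      using y edges[of "{y, x}"] by (auto simp: closed_nbhd_def neighbours_def)
    then show ?thesis
      using closed_nbhd_isolate[OF g v, of x] closed_nbhd_isolate[OF g v, of y]
      using clique_unionD(5)[OF g, of y x] clique_unionD(5)[OF g, of y v] closed_nbhd_refl[of x g]
      by (auto simp: verts_isolate split: if_splits)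
  qed
  then show ?thesis
    using edges clique_unionD(1,2,4)[OF g] by (auto simp: clique_union_def verts_isolate edges_isolate)
qed

text \<open>The members of one clique count all together or not at all. A step at \<open>v\<close>
  changes only this clique, so the first summand is common to the counts before and after.\<close>

lemma num_deg_pred_split:
  assumes g: "clique_union g" and v: "v \<in> verts g"
  shows "num_deg_pred g k = card {x \<in> verts g - closed_nbhd g v. card (closed_nbhd g x) = k}
    + (if card (closed_nbhd g v) = k then k else 0)"
proof -
  let ?S = "closed_nbhd g v"
  have sub: "?S \<subseteq> verts g"
    using v by (auto simp: closed_nbhd_eq_if_mem_verts)
  have fin: "finite (verts g)" by (rule clique_unionD(1)[OF g])
  have "{x \<in> verts g. card (closed_nbhd g x) = k} =
      {x \<in> verts g - ?S. card (closed_nbhd g x) = k} \<union> (if card ?S = k then ?S else {})"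
    using sub clique_unionD(5)[OF g, of _ v] by auto
  moreover have "card \<dots> = card {x \<in> verts g - ?S. card (closed_nbhd g x) = k}
      + card (if card ?S = k then ?S else {})"
    using fin finite_subset[OF sub] by (intro card_Un_disjoint) auto
  ultimately show ?thesis
    by (simp add: num_deg_pred_eq[OF g])
qed

text \<open>A clique of size \<open>c\<close> becomes one of size \<open>c + 1\<close>. Losses stand
  on the left to avoid truncated subtraction.\<close>

lemma num_deg_pred_duplicate:
  assumes g: "clique_union g" and v: "v \<in> verts g"
  shows "num_deg_pred (duplicate_vertex v g) k + (if card (closed_nbhd g v) = k then k else 0)
    = num_deg_pred g k + (if Suc (card (closed_nbhd g v)) = k then k else 0)"
proof -
  let ?S = "closed_nbhd g v" and ?w = "fresh_vertex g" and ?h = "duplicate_vertex v g"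
  let ?A = "{x \<in> verts g - ?S. card (closed_nbhd g x) = k}"
  have sub: "?S \<subseteq> verts g"
    using v by (auto simp: closed_nbhd_eq_if_mem_verts)
  have fin: "finite (verts g)" by (rule clique_unionD(1)[OF g])
  have finS: "finite ?S" using finite_subset[OF sub fin] .
  have w: "?w \<notin> verts g" by (rule fresh_vertex_notin[OF fin])
  have cardw: "card (insert ?w ?S) = Suc (card ?S)"
    using finS w sub by (auto simp: card_insert_if)
  have "{x \<in> verts ?h. card (closed_nbhd ?h x) = k} =
      {x \<in> verts ?h. card (if x \<in> insert ?w ?S then insert ?w ?S else closed_nbhd g x) = k}"
    by (intro Collect_cong conj_cong) (simp_all add: verts_duplicate closed_nbhd_duplicate[OF g v])
  also have "\<dots> = ?A \<union> (if Suc (card ?S) = k then insert ?w ?S else {})"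
    using sub w cardw by (auto simp: verts_duplicate)
  moreover have "card \<dots> = card ?A + card (if Suc (card ?S) = k then insert ?w ?S else {})"
    using fin finS w by (intro card_Un_disjoint) auto
  ultimately show ?thesis
    using cardw
    by (simp add: num_deg_pred_eq[OF clique_union_duplicate[OF g v]] num_deg_pred_split[OF g v])
qed

text \<open>A clique of size \<open>c\<close> splits into one of size \<open>c - 1\<close> and the
  single vertex \<open>v\<close>, which is the last summand. If \<open>v\<close> was isolated
  already, loss and gain at \<open>k = 1\<close> cancel.\<close>

lemma num_deg_pred_isolate:
  assumes g: "clique_union g" and v: "v \<in> verts g"
  shows "num_deg_pred (isolate_vertex v g) k + (if card (closed_nbhd g v) = k then k else 0)
    = num_deg_pred g k + (if card (closed_nbhd g v) = Suc k then k else 0) + (if k = 1 then 1 else 0)"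
proof -
  let ?S = "closed_nbhd g v" and ?h = "isolate_vertex v g"
  let ?A = "{x \<in> verts g - ?S. card (closed_nbhd g x) = k}"
  let ?B = "if card ?S = Suc k then ?S - {v} else {}" and ?C = "if k = 1 then {v} else {}"
  have sub: "?S \<subseteq> verts g"
    using v by (auto simp: closed_nbhd_eq_if_mem_verts)
  have fin: "finite (verts g)" by (rule clique_unionD(1)[OF g])
  have finS: "finite ?S" using finite_subset[OF sub fin] .
  have cardv: "card ?S = Suc (card (?S - {v}))"
    using finS closed_nbhd_refl[of v g] by (metis card_Suc_Diff1)
  have "{x \<in> verts ?h. card (closed_nbhd ?h x) = k} =
      {x \<in> verts g. card (if x = v then {v} else if x \<in> ?S then ?S - {v} else closed_nbhd g x) = k}"
    using v by (intro Collect_cong conj_cong) (simp_all add: verts_isolate closed_nbhd_isolate[OF g v])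
  also have "\<dots> = (?A \<union> ?B) \<union> ?C"
    using sub cardv v closed_nbhd_refl[of v g] by auto
  moreover have "card \<dots> = card (?A \<union> ?B) + card ?C"
    using fin finS closed_nbhd_refl[of v g] by (intro card_Un_disjoint) auto
  moreover have "card (?A \<union> ?B) = card ?A + card ?B"
    using fin finS by (intro card_Un_disjoint) auto
  ultimately show ?thesis
    using cardv
    by (simp add: num_deg_pred_eq[OF clique_union_isolate[OF g v]] num_deg_pred_split[OF g v] verts_isolate)
qed

section \<open>Support and drift of the transition kernel\<close>

lemma set_pmf_dup_del_step_subset:
  assumes "finite (verts g)" "verts g \<noteq> {}"
  shows "set_pmf (dup_del_step p g) \<subseteq>
    (\<lambda>v. duplicate_vertex v g) ` verts g \<union> (\<lambda>v. isolate_vertex v g) ` verts g"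
  using assms by (auto simp: dup_del_step_def split: if_splits)

lemma expectation_dup_del_step:
  fixes f :: "ugraph \<Rightarrow> real"
  assumes p: "0 \<le> p" "p \<le> 1" and g: "finite (verts g)" "verts g \<noteq> {}"
  shows "measure_pmf.expectation (dup_del_step p g) f =
    (\<Sum>v\<in>verts g. p * f (duplicate_vertex v g) + (1 - p) * f (isolate_vertex v g)) / card (verts g)"
proof -
  have fin: "finite (set_pmf (do {v \<leftarrow> pmf_of_set (verts g);
      return_pmf (if dup then duplicate_vertex v g else isolate_vertex v g)}))" for dup
    using g by simp
  have inner: "measure_pmf.expectation (do {v \<leftarrow> pmf_of_set (verts g);
      return_pmf (if dup then duplicate_vertex v g else isolate_vertex v g)}) f
    = (\<Sum>v\<in>verts g. f (if dup then duplicate_vertex v g else isolate_vertex v g)) / card (verts g)" for dup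
    using g by (subst pmf_expectation_bind_pmf_of_set) (auto simp: divide_inverse sum_distrib_left mult.commute)
  show ?thesis
    unfolding dup_del_step_def
    using p g
    by (subst pmf_expectation_bind[where A=UNIV])
      (auto simp: fin inner UNIV_bool sum.distrib add_divide_distrib sum_distrib_left)
qed

text \<open>In the drift of \<open>D\<^sub>1\<close>, the vertices isolated by deletion act as a supply of
  \<open>d\<^sub>0 N\<close> virtual vertices of index 0.\<close>

definition weighted_count :: "real \<Rightarrow> ugraph \<Rightarrow> nat \<Rightarrow> real" where
  "weighted_count p g k =
     (if k = 0 then (1 - p) / p * real (num_vertices g) else real (num_deg_pred g k))"

lemma num_deg_pred_0: "num_deg_pred g 0 = 0"
  by (simp add: num_deg_pred_def)

lemma sum_closed_nbhd_card:
  assumes "clique_union g"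
  shows "(\<Sum>v\<in>verts g. if card (closed_nbhd g v) = k then c else 0) = real (num_deg_pred g k) * c"
  using clique_unionD(1)[OF assms]
  by (simp add: num_deg_pred_eq[OF assms] sum.If_cases Int_def)

text \<open>A uniform vertex hits a clique of size \<open>j\<close> with probability
  \<open>D j / N\<close>, where \<open>D j\<close> counts the vertices in such cliques. Size
  \<open>k\<close> gains \<open>k\<close> vertices by duplication at size \<open>k - 1\<close> or
  deletion at size \<open>k + 1\<close>, and loses \<open>k\<close> in either step at size
  \<open>k\<close>.\<close>

lemma expectation_num_deg_pred:
  assumes p: "0 < p" "p < 1" and g: "clique_union g" and k: "k \<ge> 1"
  shows "measure_pmf.expectation (dup_del_step p g) (\<lambda>h. real (num_deg_pred h k))
    - real (num_deg_pred g k) = real k / real (num_vertices g) *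
      (p * weighted_count p g (k - 1) + (1 - p) * weighted_count p g (k + 1) - weighted_count p g k)"
proof -
  let ?N = "real (card (verts g))" and ?c = "\<lambda>v. card (closed_nbhd g v)"
  let ?D = "\<lambda>j. real (num_deg_pred g j)"
  have N: "?N > 0"
    using clique_unionD(1,2)[OF g] by (simp add: card_gt_0_iff)
  have dup: "real (num_deg_pred (duplicate_vertex v g) k)
      = ?D k - (if ?c v = k then real k else 0) + (if ?c v = k - 1 then real k else 0)"
    if "v \<in> verts g" for v
    using num_deg_pred_duplicate[OF g that, of k] k by (auto split: if_splits)
  have iso: "real (num_deg_pred (isolate_vertex v g) k)
      = ?D k - (if ?c v = k then real k else 0) + (if ?c v = Suc k then real k else 0)
        + (if k = 1 then 1 else 0)"
    if "v \<in> verts g" for v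
    using num_deg_pred_isolate[OF g that, of k] by (auto split: if_splits)
  have "(\<Sum>v\<in>verts g. p * real (num_deg_pred (duplicate_vertex v g) k)
        + (1 - p) * real (num_deg_pred (isolate_vertex v g) k))
      = (\<Sum>v\<in>verts g. ?D k - (if ?c v = k then real k else 0)
          + p * (if ?c v = k - 1 then real k else 0)
          + (1 - p) * (if ?c v = Suc k then real k else 0) + (1 - p) * (if k = 1 then 1 else 0))"
    by (intro sum.cong refl) (simp only: dup iso, simp add: algebra_simps)
  also have "\<dots> = ?N * ?D k - ?D k * real k + p * (?D (k - 1) * real k)
      + (1 - p) * (?D (Suc k) * real k) + ?N * ((1 - p) * (if k = 1 then 1 else 0))"
    by (simp only: sum.distrib sum_subtractf sum_distrib_left[symmetric] sum_closed_nbhd_card[OF g]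
        sum_constant) (simp only: mult_ac)
  finally have "measure_pmf.expectation (dup_del_step p g) (\<lambda>h. real (num_deg_pred h k)) =
      (?N * ?D k - ?D k * real k + p * (?D (k - 1) * real k)
      + (1 - p) * (?D (Suc k) * real k) + ?N * ((1 - p) * (if k = 1 then 1 else 0))) / ?N"
    using p clique_unionD(1,2)[OF g] by (subst expectation_dup_del_step) auto
  also have "\<dots> = ?D k + real k / ?N * (p * ?D (k - 1) + (1 - p) * ?D (Suc k) - ?D k
      + (1 - p) * (if k = 1 then ?N else 0))"
    using N by (simp add: field_simps)
  \<comment> \<open>For \<open>k = 1\<close> the true count \<open>?D 0\<close> is 0, and the newly
    isolated vertex accounts for \<open>(1 - p) * ?N = p * weighted_count p g 0\<close>.\<close>
  also have "p * ?D (k - 1) + (1 - p) * ?D (Suc k) - ?D k + (1 - p) * (if k = 1 then ?N else 0) =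
      p * weighted_count p g (k - 1) + (1 - p) * weighted_count p g (k + 1) - weighted_count p g k"
    using p k by (simp add: weighted_count_def num_vertices_def num_deg_pred_0)
  finally show ?thesis
    by (simp add: num_vertices_def)
qed

lemma expectation_num_vertices:
  assumes p: "0 < p" "p < 1" and g: "clique_union g"
  shows "measure_pmf.expectation (dup_del_step p g) (\<lambda>h. real (num_vertices h))
    - real (num_vertices g) = p"
proof -
  let ?N = "real (card (verts g))"
  note fin = clique_unionD(1,2)[OF g]
  have N: "?N > 0"
    using fin by (simp add: card_gt_0_iff)
  have "measure_pmf.expectation (dup_del_step p g) (\<lambda>h. real (num_vertices h)) =
      (\<Sum>v\<in>verts g. p * (1 + ?N) + (1 - p) * ?N) / ?N"
    using p fin fresh_vertex_notin[OF fin(1)]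
    by (subst expectation_dup_del_step) (auto simp: num_vertices_def verts_duplicate verts_isolate)
  also have "\<dots> = ?N + p"
    using N by (simp add: field_simps)
  finally show ?thesis by (simp add: num_vertices_def)
qed

text \<open>A bound depending on \<open>k\<close> alone suffices for the law of large numbers. The
  value \<open>k + 1\<close> is attained at \<open>k = 1\<close>, when deletion turns a clique of
  size 2 into two isolated vertices.\<close>

lemma num_deg_pred_dup_del_step_diff:
  assumes g: "clique_union g" and h: "h \<in> set_pmf (dup_del_step p g)"
  shows "\<bar>real (num_deg_pred h k) - real (num_deg_pred g k)\<bar> \<le> real (k + 1)"
proof -
  obtain v where "v \<in> verts g" "h = duplicate_vertex v g \<or> h = isolate_vertex v g"
    using set_pmf_dup_del_step_subset[OF clique_unionD(1,2)[OF g]] h by blast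
  then show ?thesis
    using num_deg_pred_duplicate[OF g, of v k] num_deg_pred_isolate[OF g, of v k]
    by (auto split: if_splits)
qed

lemma num_vertices_dup_del_step_diff:
  assumes g: "clique_union g" and h: "h \<in> set_pmf (dup_del_step p g)"
  shows "\<bar>real (num_vertices h) - real (num_vertices g)\<bar> \<le> 1"
proof -
  obtain v where "h = duplicate_vertex v g \<or> h = isolate_vertex v g"
    using set_pmf_dup_del_step_subset[OF clique_unionD(1,2)[OF g]] h by blast
  then show ?thesis
    using clique_unionD(1)[OF g]
    by (auto simp: num_vertices_def verts_duplicate verts_isolate card_insert_if)
qed

lemma clique_union_dup_del_step:
  assumes g: "clique_union g" and h: "h \<in> set_pmf (dup_del_step p g)"
  shows "clique_union h"
  using set_pmf_dup_del_step_subset[OF clique_unionD(1,2)[OF g]] h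
    clique_union_duplicate[OF g] clique_union_isolate[OF g] by blast

text \<open>Finiteness of these sets turns conditional expectations into finite sums.\<close>

fun reachable_graphs :: "real \<Rightarrow> nat \<Rightarrow> ugraph set" where
  "reachable_graphs p 0 = {single_vertex}"
| "reachable_graphs p (Suc m) = (\<Union>g\<in>reachable_graphs p m. set_pmf (dup_del_step p g))"

lemma clique_union_reachable: "g \<in> reachable_graphs p m \<Longrightarrow> clique_union g"
  by (induction m arbitrary: g) (auto simp: clique_union_single intro: clique_union_dup_del_step)

lemma finite_reachable: "finite (reachable_graphs p m)"
proof (induction m)
  case (Suc m)
  have "finite (set_pmf (dup_del_step p g))" if "g \<in> reachable_graphs p m" for g
    using set_pmf_dup_del_step_subset clique_unionD(1,2)[OF clique_union_reachable[OF that]]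
    by (meson finite_UnI finite_imageI finite_subset)
  then show ?case using Suc by simp
qed simp

subsection \<open>Almost sure behaviour of the process\<close>

context dup_del_process
begin

declare measurable_G [measurable]

section \<open>Finite histories and their probabilities\<close>

definition history :: "nat \<Rightarrow> (nat \<Rightarrow> ugraph) \<Rightarrow> 'a set" where
  "history m g = {\<omega> \<in> space M. \<forall>i\<le>m. G i \<omega> = g i}"

text \<open>Extensional functions represent each path up to time \<open>m\<close> exactly once, so
  the set is finite.\<close>

definition histories :: "nat \<Rightarrow> (nat \<Rightarrow> ugraph) set" where
  "histories m = PiE {..m} (reachable_graphs p)"

lemma sets_history_step [measurable]: "{\<omega> \<in> history m g. G (Suc m) \<omega> \<in> H} \<in> events"
proof -
  have "{\<omega> \<in> history m g. G (Suc m) \<omega> \<in> H} =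
      (\<Inter>i\<in>{..m}. G i -` {g i} \<inter> space M) \<inter> (G (Suc m) -` H \<inter> space M)"
    by (auto simp: history_def)
  also have "\<dots> \<in> events"
    by (intro sets.Int sets.finite_INT measurable_sets[OF measurable_G]) auto
  finally show ?thesis .
qed

lemma sets_history [measurable]: "history m g \<in> events"
  using sets_history_step[of m g UNIV] by simp

lemma finite_histories: "finite (histories m)"
  unfolding histories_def by (intro finite_PiE finite_reachable) auto

text \<open>The product form of the transition law also covers null histories, where both sides
  vanish.\<close>

lemma prob_history_step:
  "prob {\<omega> \<in> history m g. G (Suc m) \<omega> = h} = prob (history m g) * pmf (dup_del_step p (g m)) h"
proof (cases "prob (history m g) = 0")
  case True
  have "prob {\<omega> \<in> history m g. G (Suc m) \<omega> = h} \<le> prob (history m g)"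
    by (intro finite_measure_mono sets_history) auto
  then show ?thesis
    using True measure_nonneg[of M "{\<omega> \<in> history m g. G (Suc m) \<omega> = h}"] by simp
next
  case False
  then have pos: "prob (history m g) > 0"
    using measure_nonneg[of M "history m g"] by linarith
  have "{\<omega> \<in> space M. G (Suc m) \<omega> = h \<and> (\<forall>i\<le>m. G i \<omega> = g i)} = {\<omega> \<in> history m g. G (Suc m) \<omega> = h}"
    by (auto simp: history_def)
  then have "prob {\<omega> \<in> history m g. G (Suc m) \<omega> = h} / prob (history m g)
      = pmf (dup_del_step p (g m)) h"
    using transition[of m g h] pos by (simp add: cond_prob_def history_def)
  then show ?thesis
    using pos by (simp add: field_simps)
qed

lemma finite_set_pmf_step:
  assumes "g \<in> reachable_graphs p m"
  shows "finite (set_pmf (dup_del_step p g))"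
  by (rule finite_subset[OF _ finite_reachable[of p "Suc m"]]) (use assms in auto)

text \<open>Summing the product form over the finite support recovers the full probability of the
  history.\<close>

lemma AE_history_step:
  assumes g: "g \<in> histories m"
  shows "AE \<omega> in M. \<omega> \<in> history m g \<longrightarrow> G (Suc m) \<omega> \<in> set_pmf (dup_del_step p (g m))"
proof -
  let ?S = "set_pmf (dup_del_step p (g m))"
  have fin: "finite ?S"
    by (rule finite_set_pmf_step[of _ m]) (use g in \<open>auto simp: histories_def PiE_iff\<close>)
  have "prob {\<omega> \<in> history m g. G (Suc m) \<omega> \<in> ?S} = prob (\<Union>h\<in>?S. {\<omega> \<in> history m g. G (Suc m) \<omega> = h})"
    by (rule arg_cong[where f=prob]) auto
  also have "\<dots> = (\<Sum>h\<in>?S. prob {\<omega> \<in> history m g. G (Suc m) \<omega> = h})"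
    using sets_history_step[of m g "{_}"] fin
    by (intro finite_measure_finite_Union) (auto simp: disjoint_family_on_def)
  also have "\<dots> = prob (history m g)"
    using fin by (simp add: prob_history_step sum_distrib_left[symmetric] sum_pmf_eq_1)
  finally have "prob (history m g - {\<omega> \<in> history m g. G (Suc m) \<omega> \<in> ?S}) = 0"
    by (subst finite_measure_Diff) auto
  then have "AE \<omega> in M. \<omega> \<notin> history m g - {\<omega> \<in> history m g. G (Suc m) \<omega> \<in> ?S}"
    by (subst (asm) prob_eq_0) auto
  then show ?thesis
    by eventually_elim auto
qed

lemma reachable_if_steps:
  assumes "G 0 \<omega> = single_vertex" "\<forall>i<m. G (Suc i) \<omega> \<in> set_pmf (dup_del_step p (G i \<omega>))" "i \<le> m"
  shows "G i \<omega> \<in> reachable_graphs p i"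
  using assms(3)
proof (induction i)
  case (Suc i)
  then have "G (Suc i) \<omega> \<in> set_pmf (dup_del_step p (G i \<omega>))" "G i \<omega> \<in> reachable_graphs p i"
    using assms(2) by auto
  then show ?case by auto
qed (simp add: assms)

lemma restrict_mem_histories:
  assumes "\<And>i. i \<le> m \<Longrightarrow> G i \<omega> \<in> reachable_graphs p i"
  shows "restrict (\<lambda>i. G i \<omega>) {..m} \<in> histories m"
  using assms by (auto simp: histories_def)

lemma AE_steps_upto:
  "AE \<omega> in M. G 0 \<omega> = single_vertex \<and> (\<forall>i<m. G (Suc i) \<omega> \<in> set_pmf (dup_del_step p (G i \<omega>)))"
proof (induction m)
  case 0
  then show ?case using initial by simp
next
  case (Suc m)
  have "AE \<omega> in M. \<forall>g\<in>histories m. \<omega> \<in> history m g \<longrightarrow> G (Suc m) \<omega> \<in> set_pmf (dup_del_step p (g m))"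
    using AE_history_step finite_histories by (intro AE_finite_allI)
  with Suc AE_space show ?case
  proof eventually_elim
    case (elim \<omega>)
    let ?g = "restrict (\<lambda>i. G i \<omega>) {..m}"
    have "?g \<in> histories m"
      using elim reachable_if_steps by (intro restrict_mem_histories) blast
    moreover have "\<omega> \<in> history m ?g"
      using elim by (simp add: history_def)
    ultimately have "G (Suc m) \<omega> \<in> set_pmf (dup_del_step p (?g m))"
      using elim by blast
    then show ?case
      using elim by (auto simp: less_Suc_eq)
  qed
qed

lemma AE_steps:
  "AE \<omega> in M. G 0 \<omega> = single_vertex \<and> (\<forall>i. G (Suc i) \<omega> \<in> set_pmf (dup_del_step p (G i \<omega>)))"
proof -
  have "AE \<omega> in M. \<forall>m. G 0 \<omega> = single_vertex \<and>
      (\<forall>i<m. G (Suc i) \<omega> \<in> set_pmf (dup_del_step p (G i \<omega>)))"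
    using AE_steps_upto by (simp only: AE_all_countable) blast
  then show ?thesis
    by eventually_elim blast
qed

lemma AE_reachable: "AE \<omega> in M. \<forall>m. G m \<omega> \<in> reachable_graphs p m"
  using AE_steps by eventually_elim (use reachable_if_steps in blast)

section \<open>Martingale differences along the process\<close>

abbreviation step_mean :: "(ugraph \<Rightarrow> real) \<Rightarrow> ugraph \<Rightarrow> real" where
  "step_mean \<phi> g \<equiv> measure_pmf.expectation (dup_del_step p g) \<phi>"

lemma borel_measurable_G [measurable]: "(\<lambda>\<omega>. f (G m \<omega>) :: real) \<in> borel_measurable M"
  by (rule measurable_compose[OF measurable_G]) simp

text \<open>Almost surely only finitely many histories occur up to time \<open>m\<close>, so the integral is a finite sum
  over histories, on each of which \<open>F\<close> is constant.\<close>

lemma expectation_martingale_increment: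
  fixes \<phi> :: "ugraph \<Rightarrow> real" and F :: "'a \<Rightarrow> real"
  assumes [measurable]: "F \<in> borel_measurable M"
    and F: "\<And>\<omega> \<omega>'. (\<And>i. i \<le> m \<Longrightarrow> G i \<omega> = G i \<omega>') \<Longrightarrow> F \<omega> = F \<omega>'"
  shows "expectation (\<lambda>\<omega>. F \<omega> * (\<phi> (G (Suc m) \<omega>) - step_mean \<phi> (G m \<omega>))) = 0"
proof -
  define R where "R = reachable_graphs p (Suc m)"
  \<comment> \<open>The value of \<open>F\<close> along the path \<open>g\<close>; by the hypothesis
    on \<open>F\<close> any sample point following \<open>g\<close> gives the same value. If none
    does, the value is arbitrary, but then \<open>A g h\<close> is empty.\<close>
  define Fv where "Fv g = F (SOME \<omega>. \<forall>i\<le>m. G i \<omega> = g i)" for g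
  define A where "A g h = {\<omega> \<in> history m g. G (Suc m) \<omega> = h}" for g h
  have [measurable]: "A g h \<in> events" for g h
    using sets_history_step[of m g "{h}"] by (simp add: A_def)
  have fin: "finite (histories m)" "finite R"
    by (simp_all add: finite_histories finite_reachable R_def del: reachable_graphs.simps)
  have "AE \<omega> in M. F \<omega> * (\<phi> (G (Suc m) \<omega>) - step_mean \<phi> (G m \<omega>)) =
      (\<Sum>g\<in>histories m. \<Sum>h\<in>R. Fv g * (\<phi> h - step_mean \<phi> (g m)) * indicator (A g h) \<omega>)"
    using AE_reachable AE_space
  proof eventually_elim
    case (elim \<omega>)
    define g0 where "g0 = restrict (\<lambda>i. G i \<omega>) {..m}"
    have g0: "g0 \<in> histories m"
      unfolding g0_def using elim by (intro restrict_mem_histories) simp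
    have eq_g0: "(\<forall>i\<le>m. G i \<omega> = g i) \<longleftrightarrow> g = g0" if "g \<in> histories m" for g
      using that unfolding g0_def histories_def
      by (auto simp: PiE_iff extensional_def restrict_def fun_eq_iff)
    have Fv: "Fv g0 = F \<omega>"
    proof -
      have "\<forall>i\<le>m. G i (SOME \<omega>. \<forall>i\<le>m. G i \<omega> = g0 i) = g0 i"
        by (rule someI[where P="\<lambda>\<omega>. \<forall>i\<le>m. G i \<omega> = g0 i" and x=\<omega>]) (simp add: g0_def)
      then show ?thesis
        unfolding Fv_def by (intro F) (simp add: g0_def)
    qed
    have ind: "indicator (A g h) \<omega> = (if g = g0 then if h = G (Suc m) \<omega> then 1 else 0 else (0::real))"
      if "g \<in> histories m" for g h
      using eq_g0[OF that] elim by (auto simp: A_def history_def indicator_def)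
    have "(\<Sum>g\<in>histories m. \<Sum>h\<in>R. Fv g * (\<phi> h - step_mean \<phi> (g m)) * indicator (A g h) \<omega>)
        = (\<Sum>g\<in>histories m. if g = g0 then
            \<Sum>h\<in>R. if h = G (Suc m) \<omega> then Fv g * (\<phi> h - step_mean \<phi> (g m)) else 0 else 0)"
      by (intro sum.cong refl) (auto simp: ind intro!: sum.cong)
    also have "\<dots> = Fv g0 * (\<phi> (G (Suc m) \<omega>) - step_mean \<phi> (g0 m))"
      using fin g0 elim by (simp add: R_def del: reachable_graphs.simps)
    also have "step_mean \<phi> (g0 m) = step_mean \<phi> (G m \<omega>)"
      by (simp add: g0_def)
    finally show ?case
      by (simp only: Fv)
  qed
  then have "expectation (\<lambda>\<omega>. F \<omega> * (\<phi> (G (Suc m) \<omega>) - step_mean \<phi> (G m \<omega>))) =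
      expectation (\<lambda>\<omega>. \<Sum>g\<in>histories m. \<Sum>h\<in>R.
        Fv g * (\<phi> h - step_mean \<phi> (g m)) * indicator (A g h) \<omega>)"
    by (intro integral_cong_AE) auto
  also have "\<dots> = (\<Sum>g\<in>histories m. \<Sum>h\<in>R. Fv g * (\<phi> h - step_mean \<phi> (g m)) * prob (A g h))"
    by (simp add: Bochner_Integration.integral_sum integrable_mult_right integrable_real_indicator
        emeasure_finite top.not_eq_extremum[symmetric])
  also have "\<dots> = (\<Sum>g\<in>histories m. 0)"
  proof (rule sum.cong[OF refl])
    fix g assume g: "g \<in> histories m"
    then have "g m \<in> reachable_graphs p m"
      by (auto simp: histories_def)
    then have sub: "set_pmf (dup_del_step p (g m)) \<subseteq> R"
      by (auto simp: R_def)
    \<comment> \<open>The probability of \<open>A g h\<close> factorises, which leaves the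
      conditional mean of \<open>\<phi>\<close> minus itself.\<close>
    have "(\<Sum>h\<in>R. Fv g * (\<phi> h - step_mean \<phi> (g m)) * prob (A g h)) =
      Fv g * prob (history m g) * ((\<Sum>h\<in>R. \<phi> h * pmf (dup_del_step p (g m)) h)
        - step_mean \<phi> (g m) * (\<Sum>h\<in>R. pmf (dup_del_step p (g m)) h))"
      by (simp add: A_def prob_history_step sum_distrib_left sum_subtractf[symmetric] algebra_simps)
    also have "(\<Sum>h\<in>R. pmf (dup_del_step p (g m)) h) = 1"
      by (rule sum_pmf_eq_1[OF fin(2) sub])
    also have "(\<Sum>h\<in>R. \<phi> h * pmf (dup_del_step p (g m)) h) = step_mean \<phi> (g m)"
      using sub by (intro integral_measure_pmf_real[symmetric] fin(2)) auto
    finally show "(\<Sum>h\<in>R. Fv g * (\<phi> h - step_mean \<phi> (g m)) * prob (A g h)) = 0"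
      by simp
  qed
  finally show ?thesis by simp
qed

lemma step_mean_diff_le:
  assumes g: "g \<in> reachable_graphs p m"
    and bound: "\<And>h. h \<in> set_pmf (dup_del_step p g) \<Longrightarrow> \<bar>\<phi> h - \<phi> g\<bar> \<le> c"
  shows "\<bar>step_mean \<phi> g - \<phi> g\<bar> \<le> c"
proof -
  let ?S = "set_pmf (dup_del_step p g)" and ?q = "pmf (dup_del_step p g)"
  have fin: "finite ?S" by (rule finite_set_pmf_step[OF g])
  have one: "(\<Sum>h\<in>?S. ?q h) = 1" by (rule sum_pmf_eq_1[OF fin order_refl])
  have "step_mean \<phi> g - \<phi> g = (\<Sum>h\<in>?S. \<phi> h * ?q h) - \<phi> g * (\<Sum>h\<in>?S. ?q h)"
    using one by (simp add: integral_measure_pmf_real[OF fin])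
  also have "\<dots> = (\<Sum>h\<in>?S. (\<phi> h - \<phi> g) * ?q h)"
    by (simp add: sum_distrib_left sum_subtractf[symmetric] algebra_simps)
  also have "\<bar>\<dots>\<bar> \<le> (\<Sum>h\<in>?S. c * ?q h)"
    using bound by (intro sum_abs[THEN order_trans] sum_mono) (auto simp: abs_mult intro!: mult_right_mono)
  also have "\<dots> = c"
    using one by (simp add: sum_distrib_left[symmetric])
  finally show ?thesis .
qed

text \<open>Up to the constant \<open>\<phi> (G 0 \<omega>)\<close>, the compensated process is a
  sum of uncorrelated increments bounded by \<open>2 * c\<close>. Its second moment therefore grows
  at most linearly, as the law of large numbers requires.\<close>

lemma AE_compensated_lim:
  fixes \<phi> :: "ugraph \<Rightarrow> real"
  assumes bound: "\<And>m g h. g \<in> reachable_graphs p m \<Longrightarrow> h \<in> set_pmf (dup_del_step p g) \<Longrightarrow>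
    \<bar>\<phi> h - \<phi> g\<bar> \<le> c"
  shows "AE \<omega> in M. (\<lambda>m. (\<phi> (G m \<omega>) - (\<Sum>i<m. step_mean \<phi> (G i \<omega>) - \<phi> (G i \<omega>))) / real m) \<longlonglongrightarrow> 0"
proof -
  define \<xi> where "\<xi> i \<omega> = \<phi> (G (Suc i) \<omega>) - step_mean \<phi> (G i \<omega>)" for i \<omega>
  define X where "X m \<omega> = (\<Sum>i<m. \<xi> i \<omega>)" for m \<omega>
  have [measurable]: "\<xi> i \<in> borel_measurable M" for i
    unfolding \<xi>_def by measurable
  have [measurable]: "X m \<in> borel_measurable M" for m
    unfolding X_def by measurable
  have \<xi>_bound: "AE \<omega> in M. \<bar>\<xi> m \<omega>\<bar> \<le> 2 * c" for m
    using AE_steps AE_reachable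
  proof eventually_elim
    case (elim \<omega>)
    have "\<bar>\<phi> (G (Suc m) \<omega>) - \<phi> (G m \<omega>)\<bar> \<le> c"
      using elim by (intro bound[of _ m]) auto
    moreover have "\<bar>step_mean \<phi> (G m \<omega>) - \<phi> (G m \<omega>)\<bar> \<le> c"
      using elim by (intro step_mean_diff_le[of _ m] bound[of _ m]) auto
    ultimately show ?case
      unfolding \<xi>_def by linarith
  qed
  have X_bound: "AE \<omega> in M. \<bar>X m \<omega>\<bar> \<le> 2 * c * real m" for m
  proof (induction m)
    case (Suc m)
    with \<xi>_bound[of m] show ?case
      by eventually_elim (simp add: X_def algebra_simps)
  qed (simp add: X_def)
  have int: "integrable M (\<lambda>\<omega>. (X m \<omega>)\<^sup>2)" for m
  proof (rule integrable_const_bound[where B="(2 * c * real m)\<^sup>2"])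
    show "AE \<omega> in M. norm ((X m \<omega>)\<^sup>2) \<le> (2 * c * real m)\<^sup>2"
      using X_bound[of m]
      by eventually_elim (metis abs_ge_zero power2_abs power_mono norm_power real_norm_def)
  qed measurable
  have int_\<xi>: "integrable M (\<lambda>\<omega>. (\<xi> m \<omega>)\<^sup>2)" for m
  proof (rule integrable_const_bound[where B="(2 * c)\<^sup>2"])
    show "AE \<omega> in M. norm ((\<xi> m \<omega>)\<^sup>2) \<le> (2 * c)\<^sup>2"
      using \<xi>_bound[of m]
      by eventually_elim (metis abs_ge_zero power2_abs power_mono norm_power real_norm_def)
  qed measurable
  have int_prod: "integrable M (\<lambda>\<omega>. X m \<omega> * \<xi> m \<omega>)" for m
  proof (rule integrable_const_bound[where B="(2 * c * real m) * (2 * c)"])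
    show "AE \<omega> in M. norm (X m \<omega> * \<xi> m \<omega>) \<le> (2 * c * real m) * (2 * c)"
      using X_bound[of m] \<xi>_bound[of m]
      by eventually_elim (unfold real_norm_def abs_mult, intro mult_mono, auto)
  qed measurable
  have second: "expectation (\<lambda>\<omega>. (X m \<omega>)\<^sup>2) \<le> (2 * c)\<^sup>2 * real m" for m
  proof (induction m)
    case (Suc m)
    \<comment> \<open>\<open>X m\<close> involves \<open>\<xi> i\<close> only for
      \<open>i < m\<close>, hence only the graphs up to time \<open>m\<close>.\<close>
    have "expectation (\<lambda>\<omega>. X m \<omega> * \<xi> m \<omega>) = 0"
      unfolding \<xi>_def
      by (rule expectation_martingale_increment) (auto simp: X_def \<xi>_def)
    moreover have "expectation (\<lambda>\<omega>. (\<xi> m \<omega>)\<^sup>2) \<le> expectation (\<lambda>_. (2 * c)\<^sup>2)"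
    proof (rule integral_mono_AE[OF int_\<xi>])
      show "AE \<omega> in M. (\<xi> m \<omega>)\<^sup>2 \<le> (2 * c)\<^sup>2"
        using \<xi>_bound[of m]
        by eventually_elim (metis abs_ge_zero power2_abs power_mono)
    qed simp
    moreover have "expectation (\<lambda>\<omega>. (X (Suc m) \<omega>)\<^sup>2) =
        expectation (\<lambda>\<omega>. (X m \<omega>)\<^sup>2 + (2 * (X m \<omega> * \<xi> m \<omega>) + (\<xi> m \<omega>)\<^sup>2))"
      by (rule arg_cong[where f=expectation]) (simp add: X_def power2_eq_square algebra_simps)
    ultimately show ?case
      using Suc int int_\<xi> int_prod by (simp add: prob_space algebra_simps)
  qed (simp add: X_def)
  have "AE \<omega> in M. \<bar>X (Suc m) \<omega> - X m \<omega>\<bar> \<le> 2 * c" for m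
    using \<xi>_bound[of m] by (simp add: X_def)
  then have "AE \<omega> in M. (\<lambda>m. X m \<omega> / real m) \<longlonglongrightarrow> 0"
    using int second by (intro AE_lim_over_n_second_moment) auto
  then show ?thesis
  proof eventually_elim
    case (elim \<omega>)
    have "\<phi> (G m \<omega>) - (\<Sum>i<m. step_mean \<phi> (G i \<omega>) - \<phi> (G i \<omega>)) = X m \<omega> + \<phi> (G 0 \<omega>)" for m
      by (induction m) (simp_all add: X_def \<xi>_def)
    moreover have "(\<lambda>m. X m \<omega> / real m + \<phi> (G 0 \<omega>) / real m) \<longlonglongrightarrow> 0 + 0"
      by (intro tendsto_add elim lim_const_over_n)
    ultimately show ?case
      by (simp add: add_divide_distrib)
  qed
qed

text \<open>The recurrence couples all \<open>k\<close>, so a single almost sure event is taken for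
  all of them. On it the argument is deterministic: the lower limits are compared with
  \<open>d\<close> as a supersolution.\<close>

lemma AE_liminf_ge:
  assumes p: "0 < p" "p < 1" and d: "pos_bdd_solution p d"
  shows "AE \<omega> in M. \<forall>k\<ge>1. ereal (d k) \<le>
    liminf (\<lambda>m. ereal (real (num_deg_pred (G m \<omega>) k) / real (num_vertices (G m \<omega>))))"
proof -
  have N: "AE \<omega> in M. (\<lambda>m. (real (num_vertices (G m \<omega>)) -
      (\<Sum>i<m. step_mean (\<lambda>g. real (num_vertices g)) (G i \<omega>) - real (num_vertices (G i \<omega>)))) / real m)
      \<longlonglongrightarrow> 0"
    using num_vertices_dup_del_step_diff clique_union_reachable
    by (intro AE_compensated_lim[where c=1]) blast
  have D: "AE \<omega> in M. \<forall>k. (\<lambda>m. (real (num_deg_pred (G m \<omega>) k) -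
      (\<Sum>i<m. step_mean (\<lambda>g. real (num_deg_pred g k)) (G i \<omega>) - real (num_deg_pred (G i \<omega>) k))) / real m)
      \<longlonglongrightarrow> 0"
    unfolding AE_all_countable
  proof
    fix k
    show "AE \<omega> in M. (\<lambda>m. (real (num_deg_pred (G m \<omega>) k) -
      (\<Sum>i<m. step_mean (\<lambda>g. real (num_deg_pred g k)) (G i \<omega>) - real (num_deg_pred (G i \<omega>) k))) / real m)
      \<longlonglongrightarrow> 0"
      using num_deg_pred_dup_del_step_diff clique_union_reachable
      by (intro AE_compensated_lim[where c="real (k + 1)"]) blast
  qed
  from N D AE_reachable show ?thesis
  proof eventually_elim
    case (elim \<omega>)
    define n where "n m = real (num_vertices (G m \<omega>))" for m
    define w where "w k m = weighted_count p (G m \<omega>) k" for k m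
    define l where "l k = liminf (\<lambda>m. ereal (w k m / n m))" for k
    define b where "b k = real_of_ereal (l k)" for k
    have clique: "clique_union (G m \<omega>)" for m
      using elim(3) clique_union_reachable by blast
    have n_pos: "n m > 0" for m
      using clique_unionD(1,2)[OF clique[of m]] by (simp add: n_def num_vertices_def card_gt_0_iff)
    have w_nonneg: "w k m \<ge> 0" for k m
      using p by (simp add: w_def weighted_count_def)
    \<comment> \<open>True proportions are at most 1, while the virtual index 0 has ratio
      \<open>(1 - p) / p\<close>. Boundedness makes the lower limits finite, so passing to the real
      \<open>b k\<close> loses nothing.\<close>
    define B where "B = max 1 ((1 - p) / p)"
    have w_le: "w k m / n m \<le> B" for k m
    proof (cases "k = 0")
      case True
      then show ?thesis
        using n_pos[of m] by (simp add: w_def weighted_count_def n_def B_def)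
    next
      case False
      have "num_deg_pred (G m \<omega>) k \<le> num_vertices (G m \<omega>)"
        unfolding num_deg_pred_def num_vertices_def
        by (intro card_mono clique_unionD(1)[OF clique]) auto
      then have "w k m / n m \<le> 1"
        using False n_pos[of m] by (simp add: w_def weighted_count_def n_def)
      then show ?thesis by (simp add: B_def)
    qed
    have l_bounds: "0 \<le> l k" "l k \<le> ereal B" for k
    proof -
      show "0 \<le> l k"
        unfolding l_def using w_nonneg[of k] n_pos
        by (intro Liminf_bounded always_eventually) (auto simp: less_imp_le)
      show "l k \<le> ereal B"
        unfolding l_def using w_le[of k]
        by (intro order_trans[OF Liminf_le_Limsup Limsup_bounded] always_eventually) auto
    qed
    then have b: "ereal (b k) = l k" for k
      using l_bounds[of k] unfolding b_def by (cases "l k") auto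
    have "b k \<ge> 0" for k
      using l_bounds(1)[of k] by (simp flip: b)
    have ev: "\<forall>\<^sub>F m in sequentially. w k m \<ge> \<beta> * n m" if "\<beta> < b k" for \<beta> k
    proof -
      have "\<forall>\<^sub>F m in sequentially. ereal \<beta> < ereal (w k m / n m)"
        using that b[of k] unfolding l_def by (intro less_LiminfD) (metis less_ereal.simps(1))
      then show ?thesis
        by eventually_elim (use n_pos in \<open>simp add: field_simps less_imp_le\<close>)
    qed
    have n_lim: "(\<lambda>m. n m / real m) \<longlonglongrightarrow> p"
    proof -
      have "(\<lambda>m. (n m - p * real m) / real m) \<longlonglongrightarrow> 0"
        using elim(1) unfolding expectation_num_vertices[OF p clique] n_def by (simp add: mult.commute)
      then have "(\<lambda>m. (n m - p * real m) / real m + p) \<longlonglongrightarrow> 0 + p"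
        by (intro tendsto_intros)
      moreover have "\<forall>\<^sub>F m in sequentially. (n m - p * real m) / real m + p = n m / real m"
        using eventually_gt_at_top[of 0] by eventually_elim (simp add: field_simps)
      ultimately show ?thesis
        by (simp add: tendsto_cong)
    qed
    have b0: "b 0 = (1 - p) / p"
    proof -
      have "w 0 m / n m = (1 - p) / p" for m
        using n_pos[of m] by (simp add: w_def weighted_count_def n_def)
      then show ?thesis
        using b[of 0] unfolding l_def by (simp add: Liminf_const)
    qed
    have super: "(real k + p) * b k \<ge> real k * (p * b (k - 1) + (1 - p) * b (k + 1))"
      if k: "k \<ge> 1" for k
    proof -
      let ?s = "p * b (k - 1) + (1 - p) * b (k + 1)"
      \<comment> \<open>A ratio eventually exceeds only numbers strictly below its lower limit. As
        the weights \<open>p\<close> and \<open>1 - p\<close> sum to 1, giving up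
        \<open>\<epsilon>\<close> in both neighbours costs exactly \<open>\<epsilon>\<close> in
        \<open>?s\<close>.\<close>
      have "real k * (?s - \<epsilon>) / (real k + p) \<le> b k" if "\<epsilon> > 0" for \<epsilon>
      proof (rule dense_le)
        fix \<gamma> assume \<gamma>: "\<gamma> < real k * (?s - \<epsilon>) / (real k + p)"
        define u where "u m = p * w (k - 1) m + (1 - p) * w (k + 1) m" for m
        have "\<forall>\<^sub>F m in sequentially. w (k - 1) m \<ge> (b (k - 1) - \<epsilon>) * n m"
          "\<forall>\<^sub>F m in sequentially. w (k + 1) m \<ge> (b (k + 1) - \<epsilon>) * n m"
          using that by (intro ev; simp)+
        then have "\<forall>\<^sub>F m in sequentially. u m \<ge> (?s - \<epsilon>) * n m"
        proof eventually_elim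
          case (elim m)
          have "(?s - \<epsilon>) * n m = p * ((b (k - 1) - \<epsilon>) * n m) + (1 - p) * ((b (k + 1) - \<epsilon>) * n m)"
            by (simp add: algebra_simps)
          also have "\<dots> \<le> u m"
            unfolding u_def using elim p by (intro add_mono mult_left_mono) auto
          finally show ?case .
        qed
        \<comment> \<open>The drift formula rewrites the compensator in the shape of the
          deterministic recursion.\<close>
        moreover have "(\<lambda>m. (w k m - (\<Sum>i<m. real k / n i * (u i - w k i))) / real m) \<longlonglongrightarrow> 0"
          using elim(2)[rule_format, of k] k
          unfolding expectation_num_deg_pred[OF p clique k] u_def n_def w_def
          by (simp add: weighted_count_def)
        ultimately have "\<forall>\<^sub>F m in sequentially. w k m / n m \<ge> \<gamma>"
          using k by (intro eventually_ratio_ge[OF p(1) _ n_lim _ _ \<gamma>]) auto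
        then have "ereal \<gamma> \<le> l k"
          unfolding l_def by (intro Liminf_bounded) simp
        then show "\<gamma> \<le> b k"
          by (simp flip: b)
      qed
      then have eps: "real k * ?s - (real k + p) * b k \<le> real k * \<epsilon>" if "\<epsilon> > 0" for \<epsilon>
        using that p k by (simp add: pos_divide_le_eq algebra_simps)
      show ?thesis
      proof (rule field_le_epsilon)
        fix \<delta> :: real assume "\<delta> > 0"
        then have "real k * ?s - (real k + p) * b k \<le> real k * (\<delta> / real k)"
          using k by (intro eps) simp
        also have "\<dots> = \<delta>"
          using k by simp
        finally show "real k * ?s \<le> (real k + p) * b k + \<delta>"
          by linarith
      qed
    qed
    have "d k \<le> b k" for k
      by (rule pos_bdd_solution_le_supersolution[OF p d])
        (use b0 \<open>\<And>k. b k \<ge> 0\<close> super in auto)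
    then have le: "ereal (d k) \<le> l k" for k
      by (simp flip: b)
    show ?case
    proof (intro allI impI)
      fix k :: nat assume "k \<ge> 1"
      then show "ereal (d k) \<le>
          liminf (\<lambda>m. ereal (real (num_deg_pred (G m \<omega>) k) / real (num_vertices (G m \<omega>))))"
        using le[of k] by (simp add: l_def w_def n_def weighted_count_def)
    qed
  qed
qed

end

theorem theorem2p1:
  fixes p :: real and M :: "'a measure" and G :: "nat \<Rightarrow> 'a \<Rightarrow> ugraph"
  assumes "0 < p" and "p < 1"
    and "dup_del_process M p G"
  shows "(\<exists>!d. pos_bdd_solution p d) \<and>
    (\<forall>d. pos_bdd_solution p d \<longrightarrow>
      (\<forall>k\<ge>1. AE \<omega> in M.
         liminf (\<lambda>m. ereal (real (num_deg_pred (G m \<omega>) k) / real (num_vertices (G m \<omega>))))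
           \<ge> ereal (d k)))"
proof (intro conjI allI impI)
  show "\<exists>!d. pos_bdd_solution p d"
    using pos_bdd_solution_exists pos_bdd_solution_unique assms(1,2) by blast
  fix d and k :: nat
  assume d: "pos_bdd_solution p d" and k: "k \<ge> 1"
  interpret dup_del_process M p G by fact
  show "AE \<omega> in M. liminf (\<lambda>m. ereal (real (num_deg_pred (G m \<omega>) k) / real (num_vertices (G m \<omega>))))
      \<ge> ereal (d k)"
    using AE_liminf_ge[OF assms(1,2) d] by eventually_elim (use k in blast)
qed

end
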